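(* The sets $$\left\{\left(\tfrac{d}{c},\,S(d,c)\right): d,c\in\mathbf{Z},\ \gcd(d,c)=1,\ c>0,\ d+c\ \text{odd}\right\}$$ and $$\left\{\left(\tfrac{d}{c},\,S_4(d,c)\right): d,c\in\mathbf{Z},\ \gcd(d,c)=1,\ c>0,\ d\ \text{odd}\right\}$$ are dense in $\mathbf{R}\times\mathbf{Z}$.
   Context: For coprime integers $d,c$ with $c>0$ the Hardy sums are $$S(d,c)=\sum_{k=1}^{c-1}(-1)^{k+1+\lfloor dk/c\rfloor},\qquad S_4(d,c)=\sum_{k=1}^{c-1}(-1)^{\lfloor dk/c\rfloor}.$$ $\mathbf{R}\times\mathbf{Z}$ carries the product of the usual topology on $\mathbf{R}$ and the discrete topology on $\mathbf{Z}$. *)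

theory Defs
  imports "HOL-Analysis.Analysis"
begin

text \<open>
  The exponents in the Hardy sums may be negative, and \<^term>\<open>(powi)\<close> is not available on the
  type \<^typ>\<open>int\<close> (it needs an inverse), so the integer-valued sign $(-1)^m$ is defined by parity.
  The lemma below identifies it with the usual integer power.
\<close>

definition neg_one_pow :: "int \<Rightarrow> int" where
  "neg_one_pow m = (if even m then 1 else -1)"

lemma of_int_neg_one_pow: "of_int (neg_one_pow m) = (-1 :: 'a :: division_ring) powi m"
  by (simp add: neg_one_pow_def)

definition Hardy_S :: "int \<Rightarrow> int \<Rightarrow> int" where
  "Hardy_S d c = (\<Sum>k = 1..c - 1. neg_one_pow (k + 1 + \<lfloor>real_of_int (d * k) / real_of_int c\<rfloor>))"

definition Hardy_S4 :: "int \<Rightarrow> int \<Rightarrow> int" where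
  "Hardy_S4 d c = (\<Sum>k = 1..c - 1. neg_one_pow \<lfloor>real_of_int (d * k) / real_of_int c\<rfloor>)"

text \<open>
  The type \<^typ>\<open>int\<close> is an instance of \<^class>\<open>discrete_topology\<close>, so the standard topology of
  \<^typ>\<open>real \<times> int\<close> is the product of the usual and the discrete topology.
\<close>

end

theory Submission
  imports Defs
begin

text \<open>
  The Hardy sum \<open>S\<close>, as a function of \<open>x = d/c\<close> with \<open>d + c\<close> odd, is invariant under
  \<open>x \<mapsto> x + 2\<close>, and the reciprocity law \<open>S(d,c) + S(c,d) = 1\<close> makes it change by \<open>- sgn x\<close> under
  \<open>x \<mapsto> -1/x\<close>. Hence the set of all \<open>x\<close> such that \<open>(x,n)\<close> is a limit of points \<open>(d/c, S(d,c))\<close> for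
  every \<open>n\<close> is closed and invariant under both maps. It contains 0: if \<open>S\<close> has the
  value \<open>n + 1\<close> at \<open>z\<close>, then it has the value \<open>n\<close> at the points \<open>-1/(z + 2m)\<close>, which tend to 0, and
  \<open>S(\<plusminus>k, k + 1) = \<plusminus>k\<close> shows that every value is attained. By Euclidean descent it contains all
  \<open>d/c\<close> with \<open>d + c\<close> odd, and these are dense. The statement on \<open>S\<^sub>4\<close> follows from
  \<open>S\<^sub>4(d,c) = - S(d + c, c)\<close>.
\<close>

section \<open>Arithmetic of the Hardy sums\<close>

lemma Hardy_S_div: "Hardy_S d c = (\<Sum>k = 1..c - 1. neg_one_pow (k + 1 + d * k div c))"
  unfolding Hardy_S_def by (simp only: floor_divide_of_int_eq)

lemma Hardy_S4_div: "Hardy_S4 d c = (\<Sum>k = 1..c - 1. neg_one_pow (d * k div c))"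
  unfolding Hardy_S4_def by (simp only: floor_divide_of_int_eq)

lemma Hardy_S_add_even_multiple:
  assumes "c > 0"
  shows "Hardy_S (d + 2 * m * c) c = Hardy_S d c"
proof -
  have "(d + 2 * m * c) * k div c = d * k div c + 2 * (m * k)" for k
  proof -
    have "(d + 2 * m * c) * k = d * k + (2 * (m * k)) * c"
      by (simp add: algebra_simps)
    then show ?thesis
      using assms by (simp only: div_mult_self1)
  qed
  then show ?thesis
    by (simp add: Hardy_S_div neg_one_pow_def)
qed

text \<open>Passing from \<open>d\<close> to \<open>d + c\<close> adds \<open>k\<close> to the
  floor, so the exponent becomes \<open>2 * k + 1\<close> plus the old one and every sign
  flips.\<close>

lemma Hardy_S4_eq:
  assumes "c > 0"
  shows "Hardy_S4 d c = - Hardy_S (d + c) c"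
proof -
  have "(d + c) * k div c = d * k div c + k" for k
    using assms by (simp add: distrib_right)
  then show ?thesis
    by (simp add: Hardy_S_div Hardy_S4_div neg_one_pow_def flip: sum_negf)
      (auto intro!: sum.cong)
qed

lemma not_dvd_mult_less:
  fixes c d k :: int
  assumes "coprime d c" "k \<in> {1..c - 1}"
  shows "\<not> c dvd d * k"
proof
  assume "c dvd d * k"
  then have "c dvd k"
    using assms(1) by (simp add: coprime_dvd_mult_right_iff coprime_commute)
  then show False
    using assms(2) zdvd_imp_le[of c k] by auto
qed

text \<open>No \<open>d * k / c\<close> with \<open>0 < k < c\<close> is an integer, so its floor
  \<open>q\<close> turns into \<open>- q - 1\<close> under negation and the parity changes.\<close>

lemma Hardy_S_uminus:
  assumes "coprime d c" "c > 0"
  shows "Hardy_S (- d) c = - Hardy_S d c"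
proof -
  have "- (d * k) div c = - (d * k div c) - 1" if "k \<in> {1..c - 1}" for k
    using not_dvd_mult_less[OF assms(1) that] assms(2)
    by (simp add: zdiv_zminus1_eq_if dvd_eq_mod_eq_0 split: if_splits)
  then show ?thesis
    by (auto simp: Hardy_S_div neg_one_pow_def simp flip: sum_negf intro!: sum.cong)
qed

section \<open>Reciprocity law and explicit values\<close>

lemma sum_neg_one_pow_odd: "(\<Sum>i = 1..2 * int n + 1. neg_one_pow (i + 1)) = 1"
proof (induction n)
  case 0
  then show ?case by (simp add: neg_one_pow_def)
next
  case (Suc n)
  have "{1..2 * int (Suc n) + 1} =
      insert (2 * int n + 3) (insert (2 * int n + 2) {1..2 * int n + 1})"
    by auto
  with Suc show ?case
    by (simp add: neg_one_pow_def)
qed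

lemma zdiv_less_iff:
  fixes a b c :: int
  assumes "c > 0"
  shows "a div c < b \<longleftrightarrow> a < b * c"
proof -
  have "a div c < b \<longleftrightarrow> of_int a / of_int c < (of_int b :: real)"
    by (simp only: floor_less_iff flip: floor_divide_of_int_eq[where 'a = real])
  also have "\<dots> \<longleftrightarrow> of_int a < (of_int (b * c) :: real)"
    using assms by (simp add: divide_less_eq)
  finally show ?thesis by (simp only: of_int_less_iff)
qed

lemma inj_on_add_div:
  fixes c d :: int
  assumes "c > 0" "d > 0"
  shows "inj_on (\<lambda>k. k + d * k div c) A"
proof (rule strict_mono_on_imp_inj_on, rule strict_mono_onI)
  fix x y :: int
  assume "x < y"
  then have "d * x div c \<le> d * y div c"
    using assms by (intro zdiv_mono1) auto
  with \<open>x < y\<close> show "x + d * x div c < y + d * y div c"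
    by simp
qed

text \<open>The hypothesis reads \<open>k/c < j/d\<close>. It gives both
  \<open>d * k div c < j\<close> and \<open>k \<le> c * j div d\<close>; hence positions of
  fractions from the two families never collide.\<close>

lemma add_div_less:
  fixes c d j k :: int
  assumes "c > 0" "d > 0" "d * k < c * j"
  shows "k + d * k div c < j + c * j div d"
proof -
  have "d * k div c < j"
    using assms by (simp add: zdiv_less_iff mult.commute)
  moreover have "\<not> c * j div d < k"
    using assms by (simp add: zdiv_less_iff mult.commute)
  ultimately show ?thesis by simp
qed

lemma add_div_image_subset:
  fixes c d :: int
  assumes "c > 0" "d > 0"
  shows "(\<lambda>k. k + d * k div c) ` {1..c - 1} \<subseteq> {1..c + d - 2}"
proof clarify
  fix k :: int
  assume k: "k \<in> {1..c - 1}"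
  then have "0 \<le> d * k div c" "d * k div c < d"
    using assms by (simp_all add: zdiv_less_iff pos_imp_zdiv_nonneg_iff)
  with k show "k + d * k div c \<in> {1..c + d - 2}"
    by auto
qed

text \<open>
  Ordering the numbers \<open>k/c\<close> and \<open>j/d\<close> in \<open>(0,1)\<close>, the number \<open>k/c\<close> gets the
  position \<open>k + \<lfloor>dk/c\<rfloor>\<close> and \<open>j/d\<close> the position \<open>j + \<lfloor>cj/d\<rfloor>\<close>, so the two Hardy sums together form
  an alternating sum over all positions.
\<close>
theorem Hardy_S_reciprocity:
  assumes "c > 0" "d > 0" "coprime d c" "odd (d + c)"
  shows "Hardy_S d c + Hardy_S c d = 1"
proof -
  define f where "f = (\<lambda>k. k + d * k div c)"
  define g where "g = (\<lambda>j. j + c * j div d)"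
  let ?A = "f ` {1..c - 1}" and ?B = "g ` {1..d - 1}"
  have inj: "inj_on f {1..c - 1}" "inj_on g {1..d - 1}"
    using assms inj_on_add_div unfolding f_def g_def by blast+
  have disj: "?A \<inter> ?B = {}"
  proof -
    have "f k \<noteq> g j" if "k \<in> {1..c - 1}" for j k
    proof -
      have "d * k \<noteq> c * j"
        using not_dvd_mult_less[OF assms(3) that] by auto
      then show ?thesis
        using add_div_less[of c d k j] add_div_less[of d c j k] assms
        unfolding f_def g_def by linarith
    qed
    then show ?thesis by blast
  qed
  \<comment> \<open>The disjoint images have \<open>(c - 1) + (d - 1)\<close> elements in total, so
    they fill the interval.\<close>
  have "?A \<union> ?B = {1..c + d - 2}"
  proof (rule card_subset_eq)
    show "?A \<union> ?B \<subseteq> {1..c + d - 2}"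
      using add_div_image_subset[of c d] add_div_image_subset[of d c] assms
      by (simp add: f_def g_def add.commute)
    have "card (?A \<union> ?B) = nat (c - 1) + nat (d - 1)"
      using inj disj by (simp add: card_Un_disjoint card_image)
    also have "\<dots> = card {1..c + d - 2}"
      using assms by simp
    finally show "card (?A \<union> ?B) = card {1..c + d - 2}" .
  qed simp
  moreover obtain n where "c + d - 2 = 2 * int n + 1"
  proof -
    obtain m where "d + c = 2 * m + 1"
      using assms(4) by (elim oddE)
    then have "c + d - 2 = 2 * int (nat (m - 1)) + 1"
      using assms by auto
    then show thesis by (rule that)
  qed
  ultimately have "1 = (\<Sum>i \<in> ?A \<union> ?B. neg_one_pow (i + 1))"
    by (simp add: sum_neg_one_pow_odd)
  also have "\<dots> = (\<Sum>k = 1..c - 1. neg_one_pow (f k + 1)) + (\<Sum>j = 1..d - 1. neg_one_pow (g j + 1))"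
    using inj disj by (simp add: sum.union_disjoint sum.reindex)
  also have "\<dots> = Hardy_S d c + Hardy_S c d"
    by (simp add: Hardy_S_div f_def g_def algebra_simps)
  finally show ?thesis by simp
qed

text \<open>The floor in the \<open>j\<close>-th term is \<open>j - 1\<close>, so each exponent is
  \<open>2 * j\<close> and each of the \<open>k\<close> terms equals 1.\<close>

lemma Hardy_S_consecutive: "Hardy_S (int k) (int k + 1) = int k"
proof -
  have "int k * j div (int k + 1) = j - 1" if "j \<in> {1..int k}" for j
  proof -
    have "int k * j = (int k + 1 - j) + (j - 1) * (int k + 1)"
      by (simp add: algebra_simps)
    moreover have "(int k + 1 - j) div (int k + 1) = 0"
      using that by (intro div_pos_pos_trivial) auto
    ultimately show ?thesis
      by (simp only: div_mult_self1)
  qed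
  then have "Hardy_S (int k) (int k + 1) = (\<Sum>j = 1..int k. 1)"
    by (auto simp: Hardy_S_div neg_one_pow_def intro!: sum.cong)
  then show ?thesis by simp
qed

section \<open>Level sets and their closures\<close>

definition Hardy_level :: "int \<Rightarrow> real set" where
  "Hardy_level n = {of_int d / of_int c | d c.
     coprime d c \<and> c > 0 \<and> odd (d + c) \<and> Hardy_S d c = n}"

lemma Hardy_levelI:
  assumes "coprime d c" "c > 0" "odd (d + c)" "Hardy_S d c = n" "x = of_int d / of_int c"
  shows "x \<in> Hardy_level n"
  using assms unfolding Hardy_level_def by blast

lemma Hardy_levelE:
  assumes "x \<in> Hardy_level n"
  obtains d c where "coprime d c" "c > 0" "odd (d + c)" "Hardy_S d c = n" "x = of_int d / of_int c"
  using assms unfolding Hardy_level_def by blast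

lemma Hardy_level_shift:
  assumes "x \<in> Hardy_level n"
  shows "x + 2 * of_int m \<in> Hardy_level n"
  using assms
proof (rule Hardy_levelE)
  fix d c
  assume *: "coprime d c" "c > 0" "odd (d + c)" "Hardy_S d c = n" "x = of_int d / of_int c"
  show ?thesis
  proof (rule Hardy_levelI)
    show "coprime (d + 2 * m * c) c"
      using *(1) by (metis coprime_iff_gcd_eq_1 gcd.commute gcd_add_mult mult.commute add.commute)
    show "Hardy_S (d + 2 * m * c) c = n"
      using * by (simp add: Hardy_S_add_even_multiple)
    show "x + 2 * of_int m = of_int (d + 2 * m * c) / of_int c"
      using * by (simp add: field_simps)
  qed (use * in auto)
qed

text \<open>The new denominator must be positive, hence the split by sign. For \<open>d > 0\<close>,
  \<open>S(-c, d) = - S(c, d) = S(d, c) - 1\<close>; for \<open>d < 0\<close>,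
  \<open>S(c, -d) = 1 - S(-d, c) = 1 + S(d, c)\<close>.\<close>

lemma Hardy_level_inversion:
  assumes "x \<in> Hardy_level (n + (if x > 0 then 1 else - 1))" "x \<noteq> 0"
  shows "- 1 / x \<in> Hardy_level n"
  using assms(1)
proof (rule Hardy_levelE)
  fix d c
  assume *: "coprime d c" "c > 0" "odd (d + c)"
    "Hardy_S d c = n + (if x > 0 then 1 else - 1)" "x = of_int d / of_int c"
  show ?thesis
  proof (cases "d > 0")
    case True
    then have "x > 0" using * by simp
    show ?thesis
    proof (rule Hardy_levelI)
      show "Hardy_S (- c) d = n"
        using * True \<open>x > 0\<close> Hardy_S_reciprocity[of c d] Hardy_S_uminus[of c d]
        by (simp add: coprime_commute)
    qed (use * True in \<open>auto simp: coprime_commute\<close>)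
  next
    case False
    moreover have "d \<noteq> 0"
      using assms(2) * by auto
    ultimately have "d < 0" by simp
    then have "x < 0"
      using * by (simp add: divide_neg_pos)
    show ?thesis
    proof (rule Hardy_levelI)
      show "Hardy_S c (- d) = n"
        using * \<open>x < 0\<close> \<open>d < 0\<close> Hardy_S_reciprocity[of c "- d"] Hardy_S_uminus[of d c]
        by simp
    qed (use * \<open>d < 0\<close> in \<open>auto simp: coprime_commute\<close>)
  qed
qed

lemma Hardy_level_nonempty: "Hardy_level n \<noteq> {}"
proof (cases "n \<ge> 0")
  case True
  then have "of_int n / of_int (n + 1) \<in> Hardy_level n"
    using Hardy_S_consecutive[of "nat n"]
    by (intro Hardy_levelI[of n "n + 1"]) auto
  then show ?thesis by blast
next
  case False
  have "coprime (- n) (1 - n)"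
    using coprime_add_one_right[of "- n"] by (simp add: add.commute)
  then have "of_int n / of_int (1 - n) \<in> Hardy_level n"
    using False Hardy_S_consecutive[of "nat (- n)"] Hardy_S_uminus[of "- n" "1 - n"]
    by (intro Hardy_levelI[of n "1 - n"]) (auto simp: add.commute)
  then show ?thesis by blast
qed

text \<open>Inversion moves between neighbouring levels; intersecting over all levels absorbs this
  shift.\<close>

definition Hardy_limits :: "real set" where
  "Hardy_limits = (\<Inter>n. closure (Hardy_level n))"

lemma closed_Hardy_limits: "closed Hardy_limits"
  unfolding Hardy_limits_def by auto

lemma Hardy_limitsI:
  assumes "\<And>n. \<exists>f. (\<forall>\<^sub>F k in sequentially. f k \<in> Hardy_level n) \<and> f \<longlonglongrightarrow> x"
  shows "x \<in> Hardy_limits"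
  unfolding Hardy_limits_def
proof
  fix n
  obtain f where "\<forall>\<^sub>F k in sequentially. f k \<in> Hardy_level n" "f \<longlonglongrightarrow> x"
    using assms by blast
  then show "x \<in> closure (Hardy_level n)"
    using closure_subset[of "Hardy_level n"]
    by (intro Lim_in_closed_set[of _ f sequentially]) (auto elim: eventually_mono)
qed

lemma Hardy_limitsE:
  assumes "x \<in> Hardy_limits"
  obtains f where "\<And>k. f k \<in> Hardy_level n" "f \<longlonglongrightarrow> x"
proof -
  have "x \<in> closure (Hardy_level n)"
    using assms unfolding Hardy_limits_def by blast
  then obtain f where "\<forall>k. f k \<in> Hardy_level n" "f \<longlonglongrightarrow> x"
    unfolding closure_sequential by (elim exE conjE)
  then show thesis
    by (intro that) simp_all
qed

lemma zero_in_Hardy_limits: "0 \<in> Hardy_limits"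
proof (rule Hardy_limitsI)
  fix n
  obtain z where z: "z \<in> Hardy_level (n + 1)"
    using Hardy_level_nonempty by blast
  define f where "f = (\<lambda>k. z + 2 * real k)"
  have lim: "filterlim f at_top sequentially"
    unfolding f_def
    by (intro filterlim_tendsto_add_at_top[OF tendsto_const]
        filterlim_tendsto_pos_mult_at_top[OF tendsto_const] filterlim_real_sequentially) simp
  then have "\<forall>\<^sub>F k in sequentially. f k > 0"
    by (simp add: filterlim_at_top_dense)
  then have "\<forall>\<^sub>F k in sequentially. - 1 / f k \<in> Hardy_level n"
  proof eventually_elim
    case (elim k)
    moreover have "f k \<in> Hardy_level (n + 1)"
      using Hardy_level_shift[OF z, of "int k"] by (simp add: f_def)
    ultimately show ?case
      by (intro Hardy_level_inversion) auto
  qed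
  moreover have "(\<lambda>k. - 1 / f k) \<longlonglongrightarrow> 0"
    using lim by (intro tendsto_divide_0[OF tendsto_const] filterlim_at_top_imp_at_infinity)
  ultimately show "\<exists>f. (\<forall>\<^sub>F k in sequentially. f k \<in> Hardy_level n) \<and> f \<longlonglongrightarrow> 0"
    by (intro exI[of _ "\<lambda>k. - 1 / f k"] conjI)
qed

lemma Hardy_limits_shift:
  assumes "x \<in> Hardy_limits"
  shows "x + 2 * of_int m \<in> Hardy_limits"
proof (rule Hardy_limitsI)
  fix n
  obtain f where f: "\<And>k. f k \<in> Hardy_level n" "f \<longlonglongrightarrow> x"
    using Hardy_limitsE[OF assms] by blast
  have "\<forall>\<^sub>F k in sequentially. f k + 2 * of_int m \<in> Hardy_level n"
    using f(1) by (simp add: Hardy_level_shift)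
  moreover have "(\<lambda>k. f k + 2 * of_int m) \<longlonglongrightarrow> x + 2 * of_int m"
    using f(2) by (intro tendsto_add tendsto_const)
  ultimately show "\<exists>f. (\<forall>\<^sub>F k in sequentially. f k \<in> Hardy_level n) \<and> f \<longlonglongrightarrow> x + 2 * of_int m"
    by (intro exI[of _ "\<lambda>k. f k + 2 * of_int m"] conjI)
qed

lemma Hardy_limits_inversion:
  assumes "x \<in> Hardy_limits" "x \<noteq> 0"
  shows "- 1 / x \<in> Hardy_limits"
proof (rule Hardy_limitsI)
  fix n
  obtain f where f: "\<And>k. f k \<in> Hardy_level (n + (if x > 0 then 1 else - 1))" "f \<longlonglongrightarrow> x"
    using Hardy_limitsE[OF assms(1)] by blast
  \<comment> \<open>The level of \<open>f k\<close> was chosen by the sign of \<open>x\<close>,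
    while inversion sees the sign of \<open>f k\<close>; near \<open>x \<noteq> 0\<close> they
    agree.\<close>
  have "\<forall>\<^sub>F k in sequentially. f k \<noteq> 0 \<and> (f k > 0 \<longleftrightarrow> x > 0)"
  proof (cases "x > 0")
    case True
    from order_tendstoD(1)[OF f(2) this] show ?thesis
      by eventually_elim (use True in auto)
  next
    case False
    with assms(2) have "x < 0" by simp
    from order_tendstoD(2)[OF f(2) this] show ?thesis
      by eventually_elim (use False in auto)
  qed
  then have "\<forall>\<^sub>F k in sequentially. - 1 / f k \<in> Hardy_level n"
  proof eventually_elim
    case (elim k)
    then show ?case
      using f(1)[of k] by (intro Hardy_level_inversion) simp_all
  qed
  moreover have "(\<lambda>k. - 1 / f k) \<longlonglongrightarrow> - 1 / x"
    using f(2) assms(2) by (intro tendsto_intros)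
  ultimately show "\<exists>f. (\<forall>\<^sub>F k in sequentially. f k \<in> Hardy_level n) \<and> f \<longlonglongrightarrow> - 1 / x"
    by (intro exI[of _ "\<lambda>k. - 1 / f k"] conjI)
qed

section \<open>Euclidean descent and density of the limit set\<close>

lemma rational_in_Hardy_limits:
  assumes "c > 0" "odd (d + c)"
  shows "of_int d / of_int c \<in> Hardy_limits"
  using assms
proof (induction "nat c" arbitrary: c d rule: less_induct)
  case less
  \<comment> \<open>An even shift brings \<open>d\<close> into \<open>-c \<le> e < c\<close>; parity
    then excludes \<open>e = -c\<close>.\<close>
  define m where "m = (d + c) div (2 * c)"
  define e where "e = d - 2 * m * c"
  have "e + c = (d + c) mod (2 * c)"
    unfolding e_def m_def by (simp add: minus_div_mult_eq_mod[symmetric] algebra_simps)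
  then have "0 \<le> e + c" "e + c < 2 * c"
    using less.prems by simp_all
  moreover have "odd (e + c)"
    using less.prems by (simp add: e_def)
  ultimately have e: "\<bar>e\<bar> < c"
    by (cases "e + c = 0") auto
  have "of_int e / of_int c \<in> Hardy_limits"
  proof (cases "e = 0")
    case True
    then show ?thesis using zero_in_Hardy_limits by simp
  next
    case False
    \<comment> \<open>This is \<open>- c / e\<close>, the inversion of \<open>e / c\<close>, written
      with the smaller positive denominator \<open>\<bar>e\<bar>\<close>.\<close>
    have "of_int (- sgn e * c) / of_int \<bar>e\<bar> \<in> Hardy_limits"
      using False e \<open>odd (e + c)\<close> by (intro less.hyps) (auto simp: sgn_if)
    moreover have "of_int (- sgn e * c) / of_int \<bar>e\<bar> = - (of_int c / of_int e :: real)"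
      by (simp add: sgn_if abs_if)
    ultimately have "- 1 / - (of_int c / of_int e :: real) \<in> Hardy_limits"
      using False less.prems by (intro Hardy_limits_inversion) auto
    then show ?thesis by simp
  qed
  from Hardy_limits_shift[OF this, of m] show ?case
    using less.prems by (simp add: e_def field_simps)
qed

lemma Hardy_limits_eq_UNIV: "Hardy_limits = UNIV"
proof -
  have "x \<in> Hardy_limits" for x
  proof -
    \<comment> \<open>Odd denominators tending to infinity; \<open>d k\<close> is the largest even
      integer up to \<open>x * c k\<close>, so the sum is odd and the error is at most
      \<open>2 / c k\<close>.\<close>
    define c where "c = (\<lambda>k. 2 * int k + 1)"
    define d where "d = (\<lambda>k. 2 * \<lfloor>x * of_int (c k) / 2\<rfloor>)"
    have c: "c k > 0" for k by (simp add: c_def)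
    have "even (d k)" "odd (c k)" for k
      by (simp_all only: c_def d_def dvd_triv_left even_add odd_one simp_thms)
    then have "of_int (d k) / of_int (c k) \<in> Hardy_limits" for k
      using c by (simp add: rational_in_Hardy_limits)
    moreover have "(\<lambda>k. of_int (d k) / of_int (c k)) \<longlonglongrightarrow> x"
    proof (rule tendsto_sandwich)
      have "x * of_int (c k) - 2 \<le> of_int (d k)" for k
        unfolding d_def by linarith
      then have "x - 2 / of_int (c k) \<le> of_int (d k) / of_int (c k)" for k
        using c[of k] by (simp add: pos_le_divide_eq left_diff_distrib)
      then show "\<forall>\<^sub>F k in sequentially. x - 2 / of_int (c k) \<le> of_int (d k) / of_int (c k)"
        by simp
      have "of_int (d k) \<le> x * of_int (c k)" for k
        unfolding d_def by linarith
      then have "of_int (d k) / of_int (c k) \<le> x" for k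
        using c[of k] by (simp add: pos_divide_le_eq)
      then show "\<forall>\<^sub>F k in sequentially. of_int (d k) / of_int (c k) \<le> x"
        by simp
      have "filterlim (\<lambda>k. 1 + 2 * real k) at_top sequentially"
        by (intro filterlim_tendsto_add_at_top[OF tendsto_const]
            filterlim_tendsto_pos_mult_at_top[OF tendsto_const] filterlim_real_sequentially) simp
      then have "(\<lambda>k. 2 / (1 + 2 * real k)) \<longlonglongrightarrow> 0"
        by (intro tendsto_divide_0[OF tendsto_const] filterlim_at_top_imp_at_infinity)
      from tendsto_diff[OF tendsto_const[of x] this]
      show "(\<lambda>k. x - 2 / of_int (c k)) \<longlonglongrightarrow> x"
        by (simp add: c_def add.commute)
    qed simp
    ultimately show ?thesis
      by (rule closed_sequentially[OF closed_Hardy_limits])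
  qed
  then show ?thesis by blast
qed

lemma closure_Hardy_level: "closure (Hardy_level n) = UNIV"
  using Hardy_limits_eq_UNIV unfolding Hardy_limits_def by blast

lemma dense_if_dense_slices:
  fixes A :: "('a :: topological_space \<times> 'b :: t1_space) set"
  assumes "\<And>n. closure {x. (x, n) \<in> A} = UNIV"
  shows "closure A = UNIV"
proof -
  have "(x, n) \<in> closure A" for x n
  proof -
    \<comment> \<open>Within the slice at height \<open>n\<close> only the first coordinate has to
      be approximated.\<close>
    have "(x, n) \<in> closure ({x. (x, n) \<in> A} \<times> {n})"
      by (simp add: closure_Times assms)
    also have "\<dots> \<subseteq> closure A"
      by (intro closure_mono) auto
    finally show ?thesis .
  qed
  then show ?thesis by auto
qed

theorem theorem1p2:
  shows "closure {(real_of_int d / real_of_int c, Hardy_S d c) | d c :: int.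
           coprime d c \<and> c > 0 \<and> odd (d + c)} = (UNIV :: (real \<times> int) set)
       \<and> closure {(real_of_int d / real_of_int c, Hardy_S4 d c) | d c :: int.
           coprime d c \<and> c > 0 \<and> odd d} = (UNIV :: (real \<times> int) set)"
    (is "closure ?A = _ \<and> closure ?A4 = _")
proof
  show "closure ?A = UNIV"
  proof (rule dense_if_dense_slices)
    fix n
    have "{x. (x, n) \<in> ?A} = Hardy_level n"
      unfolding Hardy_level_def by blast
    then show "closure {x. (x, n) \<in> ?A} = UNIV"
      by (simp only: closure_Hardy_level)
  qed
  show "closure ?A4 = UNIV"
  proof (rule dense_if_dense_slices)
    fix n
    \<comment> \<open>Since \<open>S4(d - c, c) = - S(d, c)\<close>, translating level
      \<open>- n\<close> by \<open>-1\<close> lands in the slice at \<open>n\<close>, and a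
      translate of a dense set is dense.\<close>
    have "(\<lambda>x. - 1 + x) ` Hardy_level (- n) \<subseteq> {x. (x, n) \<in> ?A4}"
    proof clarify
      fix x
      assume "x \<in> Hardy_level (- n)"
      then obtain d c where *: "coprime d c" "c > 0" "odd (d + c)" "Hardy_S d c = - n"
        "x = of_int d / of_int c"
        by (rule Hardy_levelE)
      have "coprime (d - c) c"
        using *(1) by (metis coprime_iff_gcd_eq_1 gcd_diff1)
      moreover have "- 1 + x = of_int (d - c) / of_int c"
        using * by (simp add: field_simps)
      moreover have "Hardy_S4 (d - c) c = n"
        using * Hardy_S4_eq[of c "d - c"] by simp
      ultimately show "\<exists>d c. (- 1 + x, n) = (of_int d / of_int c, Hardy_S4 d c) \<and>
          coprime d c \<and> c > 0 \<and> odd d"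
        using * by (intro exI[of _ "d - c"] exI[of _ c]) auto
    qed
    from closure_mono[OF this] show "closure {x. (x, n) \<in> ?A4} = UNIV"
      by (simp only: closure_translation closure_Hardy_level surj_plus top.extremum_unique)
  qed
qed

end
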